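(* Let $M$ be a smooth manifold of positive dimension. A symmetric generalized complex structure on $M$ is never Courant integrable.
   Context: Let $\mathbb TM=TM\oplus T^*M$ with the metric $g_{\mathrm{can}}(X+\xi,Y+\eta)=\frac12(\xi(Y)+\eta(X))$. A symmetric generalized complex structure on $M$ is a smooth field $\mathcal J$ of $g_{\mathrm{can}}$-symmetric endomorphisms of $\mathbb TM$ with $\mathcal J^2=-\mathrm{Id}$. Its holomorphic bundle is its $i$-eigenbundle $L\subset\mathbb T^{\mathbb C}M$. $\mathcal J$ is Courant integrable if the space of smooth sections of $L$ is closed under the (complex bilinear extension of the) Courant bracket $$[X+\xi,Y+\eta]=[X,Y]+L_X\eta-L_Y\xi+\tfrac12 d\big(\xi(Y)-\eta(X)\big),$$ for vector fields $X,Y$ and 1-forms $\xi,\eta$. *)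

theory Defs
  imports "HOL-Analysis.Analysis" "HOL-Library.Function_Algebras"
begin

text \<open>Pointwise scalar multiplication, complementing the pointwise ring operations of
  \<^theory>\<open>HOL-Library.Function_Algebras\<close>.\<close>

instantiation "fun" :: (type, real_vector) real_vector
begin

definition scaleR_fun :: "real \<Rightarrow> ('a \<Rightarrow> 'b) \<Rightarrow> 'a \<Rightarrow> 'b"
  where "scaleR_fun c f = (\<lambda>x. c *\<^sub>R f x)"

instance
  by standard
    (simp_all add: scaleR_fun_def plus_fun_def fun_eq_iff scaleR_add_right scaleR_add_left)

end

definition linear_map_on :: "'a::real_vector set \<Rightarrow> ('a \<Rightarrow> 'b::real_vector) \<Rightarrow> bool" where
  "linear_map_on V f \<longleftrightarrow>
     (\<forall>u\<in>V. \<forall>v\<in>V. f (u + v) = f u + f v) \<and> (\<forall>c. \<forall>u\<in>V. f (c *\<^sub>R u) = c *\<^sub>R f u)"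


section \<open>Smooth manifolds\<close>

text \<open>Both predicates are only meant for open \<open>S\<close> and finite-dimensional domain, where having
  continuous iterated directional derivatives of all orders is the usual notion.\<close>

primrec Ck_on ::
    "nat \<Rightarrow> 'a::real_normed_vector set \<Rightarrow> ('a \<Rightarrow> 'b::real_normed_vector) \<Rightarrow> bool" where
  "Ck_on 0 S f \<longleftrightarrow> continuous_on S f"
| "Ck_on (Suc k) S f \<longleftrightarrow>
     (\<forall>x\<in>S. f differentiable (at x)) \<and> (\<forall>v. Ck_on k S (\<lambda>x. frechet_derivative f (at x) v))"

definition smooth_on ::
    "'a::real_normed_vector set \<Rightarrow> ('a \<Rightarrow> 'b::real_normed_vector) \<Rightarrow> bool" where
  "smooth_on S f \<longleftrightarrow> (\<forall>k. Ck_on k S f)"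

text \<open>The manifold \<open>M\<close> is the whole type \<open>'m\<close>. Its dimension is \<open>CARD('n)\<close>, hence positive.
  A chart is a pair of its domain and its coordinate map.\<close>

type_synonym ('m, 'n) chart = "'m set \<times> ('m \<Rightarrow> real ^ 'n)"

definition smooth_atlas :: "('m::topological_space, 'n::finite) chart set \<Rightarrow> bool" where
  "smooth_atlas A \<longleftrightarrow>
     (\<forall>(U, \<phi>)\<in>A. open U \<and> open (\<phi> ` U) \<and> homeomorphism U (\<phi> ` U) \<phi> (inv_into U \<phi>)) \<and>
     (\<Union>(U, \<phi>)\<in>A. U) = UNIV \<and>
     (\<forall>(U, \<phi>)\<in>A. \<forall>(V, \<psi>)\<in>A. smooth_on (\<phi> ` (U \<inter> V)) (\<psi> \<circ> inv_into U \<phi>))"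

definition smooth_functions ::
    "('m::topological_space, 'n::finite) chart set \<Rightarrow> ('m \<Rightarrow> real) set" where
  "smooth_functions A = {f. \<forall>(U, \<phi>)\<in>A. smooth_on (\<phi> ` U) (f \<circ> inv_into U \<phi>)}"


section \<open>Tangent and cotangent bundle\<close>

text \<open>Tangent vectors at \<open>p\<close> are the derivations of \<open>C\<^sup>\<infinity>(M)\<close> at \<open>p\<close>. They are set to \<open>0\<close> on functions
  that are not smooth, and covectors are set to \<open>0\<close> outside the tangent space, so that equality
  in HOL is equality of (co)vectors.\<close>

type_synonym 'm tvec = "('m \<Rightarrow> real) \<Rightarrow> real"
type_synonym 'm covec = "'m tvec \<Rightarrow> real"

definition tangent_space ::
    "('m::topological_space, 'n::finite) chart set \<Rightarrow> 'm \<Rightarrow> 'm tvec set" where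
  "tangent_space A p = {v.
     linear_map_on (smooth_functions A) v \<and>
     (\<forall>f\<in>smooth_functions A. \<forall>g\<in>smooth_functions A. v (f * g) = f p * v g + g p * v f) \<and>
     (\<forall>f. f \<notin> smooth_functions A \<longrightarrow> v f = 0)}"

definition cotangent_space ::
    "('m::topological_space, 'n::finite) chart set \<Rightarrow> 'm \<Rightarrow> 'm covec set" where
  "cotangent_space A p = {\<xi>.
     linear_map_on (tangent_space A p) \<xi> \<and> (\<forall>v. v \<notin> tangent_space A p \<longrightarrow> \<xi> v = 0)}"

definition vector_fields ::
    "('m::topological_space, 'n::finite) chart set \<Rightarrow> ('m \<Rightarrow> 'm tvec) set" where
  "vector_fields A = {X.
     (\<forall>p. X p \<in> tangent_space A p) \<and>
     (\<forall>f\<in>smooth_functions A. (\<lambda>p. X p f) \<in> smooth_functions A)}"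

definition one_forms ::
    "('m::topological_space, 'n::finite) chart set \<Rightarrow> ('m \<Rightarrow> 'm covec) set" where
  "one_forms A = {\<xi>.
     (\<forall>p. \<xi> p \<in> cotangent_space A p) \<and>
     (\<forall>X\<in>vector_fields A. (\<lambda>p. \<xi> p (X p)) \<in> smooth_functions A)}"

definition differential ::
    "('m::topological_space, 'n::finite) chart set \<Rightarrow> ('m \<Rightarrow> real) \<Rightarrow> 'm \<Rightarrow> 'm covec" where
  "differential A f p v = (if v \<in> tangent_space A p then v f else 0)"

definition lie_bracket :: "('m \<Rightarrow> 'm tvec) \<Rightarrow> ('m \<Rightarrow> 'm tvec) \<Rightarrow> 'm \<Rightarrow> 'm tvec" where
  "lie_bracket X Y p f = X p (\<lambda>q. Y q f) - Y p (\<lambda>q. X q f)"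

text \<open>\<open>(L\<^sub>X \<eta>)(Y) = X(\<eta>(Y)) - \<eta>([X, Y])\<close>. The right-hand side is \<open>C\<^sup>\<infinity>(M)\<close>-linear in \<open>Y\<close>, so its value
  at \<open>p\<close> depends only on \<open>Y p\<close>; to evaluate the form on \<open>v\<close> at \<open>p\<close>, any vector field \<open>Y\<close> that
  extends \<open>v\<close> can be used.\<close>

definition lie_derivative ::
    "('m::topological_space, 'n::finite) chart set \<Rightarrow> ('m \<Rightarrow> 'm tvec) \<Rightarrow>
     ('m \<Rightarrow> 'm covec) \<Rightarrow> 'm \<Rightarrow> 'm covec" where
  "lie_derivative A X \<eta> p v =
     (if v \<in> tangent_space A p
      then let Y = (SOME Y. Y \<in> vector_fields A \<and> Y p = v)
           in X p (\<lambda>q. \<eta> q (Y q)) - \<eta> p (lie_bracket X Y p)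
      else 0)"


section \<open>Generalized tangent bundle\<close>

type_synonym 'm gvec = "'m tvec \<times> 'm covec"

definition gen_space ::
    "('m::topological_space, 'n::finite) chart set \<Rightarrow> 'm \<Rightarrow> 'm gvec set" where
  "gen_space A p = tangent_space A p \<times> cotangent_space A p"

definition gen_sections ::
    "('m::topological_space, 'n::finite) chart set \<Rightarrow> ('m \<Rightarrow> 'm gvec) set" where
  "gen_sections A = {a. (\<lambda>p. fst (a p)) \<in> vector_fields A \<and> (\<lambda>p. snd (a p)) \<in> one_forms A}"

definition g_can :: "'m gvec \<Rightarrow> 'm gvec \<Rightarrow> real" where
  "g_can = (\<lambda>(X, \<xi>) (Y, \<eta>). (\<xi> Y + \<eta> X) / 2)"

definition courant_bracket ::
    "('m::topological_space, 'n::finite) chart set \<Rightarrow>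
     ('m \<Rightarrow> 'm gvec) \<Rightarrow> ('m \<Rightarrow> 'm gvec) \<Rightarrow> 'm \<Rightarrow> 'm gvec" where
  "courant_bracket A a b =
     (let X = (\<lambda>p. fst (a p)); \<xi> = (\<lambda>p. snd (a p));
          Y = (\<lambda>p. fst (b p)); \<eta> = (\<lambda>p. snd (b p))
      in (\<lambda>p. (lie_bracket X Y p,
               lie_derivative A X \<eta> p - lie_derivative A Y \<xi> p
                 + (1 / 2) *\<^sub>R differential A (\<lambda>q. \<xi> q (Y q) - \<eta> q (X q)) p)))"

text \<open>A field of endomorphisms is smooth if it maps smooth sections to smooth sections.\<close>

definition symmetric_gen_complex ::
    "('m::topological_space, 'n::finite) chart set \<Rightarrow> ('m \<Rightarrow> 'm gvec \<Rightarrow> 'm gvec) \<Rightarrow> bool" where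
  "symmetric_gen_complex A J \<longleftrightarrow>
     (\<forall>p. J p ` gen_space A p \<subseteq> gen_space A p \<and> linear_map_on (gen_space A p) (J p)) \<and>
     (\<forall>a\<in>gen_sections A. (\<lambda>p. J p (a p)) \<in> gen_sections A) \<and>
     (\<forall>p. \<forall>u\<in>gen_space A p. \<forall>v\<in>gen_space A p. g_can (J p u) v = g_can u (J p v)) \<and>
     (\<forall>p. \<forall>u\<in>gen_space A p. J p (J p u) = - u)"


section \<open>Complexification and integrability\<close>

text \<open>An element \<open>u + i v\<close> of the complexified bundle is represented by the pair \<open>(u, v)\<close> of its
  real and imaginary part.\<close>

type_synonym 'm cgvec = "'m gvec \<times> 'm gvec"

definition times_i :: "'m cgvec \<Rightarrow> 'm cgvec" where
  "times_i = (\<lambda>(u, v). (- v, u))"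

definition complex_ext :: "('m gvec \<Rightarrow> 'm gvec) \<Rightarrow> 'm cgvec \<Rightarrow> 'm cgvec" where
  "complex_ext F = (\<lambda>(u, v). (F u, F v))"

definition complex_sections ::
    "('m::topological_space, 'n::finite) chart set \<Rightarrow> ('m \<Rightarrow> 'm cgvec) set" where
  "complex_sections A = {s. (\<lambda>p. fst (s p)) \<in> gen_sections A \<and> (\<lambda>p. snd (s p)) \<in> gen_sections A}"

definition complex_courant_bracket ::
    "('m::topological_space, 'n::finite) chart set \<Rightarrow>
     ('m \<Rightarrow> 'm cgvec) \<Rightarrow> ('m \<Rightarrow> 'm cgvec) \<Rightarrow> 'm \<Rightarrow> 'm cgvec" where
  "complex_courant_bracket A s t =
     (let a = (\<lambda>p. fst (s p)); b = (\<lambda>p. snd (s p));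
          c = (\<lambda>p. fst (t p)); d = (\<lambda>p. snd (t p))
      in (\<lambda>p. (courant_bracket A a c p - courant_bracket A b d p,
               courant_bracket A a d p + courant_bracket A b c p)))"

definition holomorphic_bundle ::
    "('m::topological_space, 'n::finite) chart set \<Rightarrow> ('m \<Rightarrow> 'm gvec \<Rightarrow> 'm gvec) \<Rightarrow>
     'm \<Rightarrow> 'm cgvec set" where
  "holomorphic_bundle A J p =
     {u \<in> gen_space A p \<times> gen_space A p. complex_ext (J p) u = times_i u}"

definition holomorphic_sections ::
    "('m::topological_space, 'n::finite) chart set \<Rightarrow> ('m \<Rightarrow> 'm gvec \<Rightarrow> 'm gvec) \<Rightarrow>
     ('m \<Rightarrow> 'm cgvec) set" where
  "holomorphic_sections A J =
     {s \<in> complex_sections A. \<forall>p. s p \<in> holomorphic_bundle A J p}"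

definition courant_integrable ::
    "('m::topological_space, 'n::finite) chart set \<Rightarrow> ('m \<Rightarrow> 'm gvec \<Rightarrow> 'm gvec) \<Rightarrow> bool" where
  "courant_integrable A J \<longleftrightarrow>
     (\<forall>s\<in>holomorphic_sections A J. \<forall>t\<in>holomorphic_sections A J.
        complex_courant_bracket A s t \<in> holomorphic_sections A J)"

end

theory Submission
  imports Defs
begin

text \<open>If \<open>J\<close> were integrable, then for a real function \<open>f\<close> and a section \<open>s\<close> of \<open>L\<close> the identity
  \<open>[s, f s] = (\<pi>(s) f) s - \<langle>s, s\<rangle> df\<close> would put \<open>\<langle>s, s\<rangle> df\<close> into \<open>L\<close>, where \<open>\<pi>\<close> is the projection to
  the tangent bundle. Since \<open>df\<close> is real, this forces \<open>\<langle>s, s\<rangle> df = 0\<close>. Taking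
  \<open>s = J u + i u\<close> with \<open>u = X + df\<close>, one has \<open>\<langle>s, s\<rangle> = -2 \<langle>u, u\<rangle> + 2 i \<langle>u, J u\<rangle>\<close> and
  \<open>\<langle>u, u\<rangle> = X f\<close>, which is nonzero somewhere if \<open>f\<close> is a bump function and \<open>X\<close> a suitable
  cutoff of a coordinate vector field.\<close>

section \<open>Calculus of smooth functions\<close>

lemma has_derivative_cong_open:
  assumes "open S" "x \<in> S" "\<And>y. y \<in> S \<Longrightarrow> f y = g y"
  shows "(f has_derivative D) (at x) \<longleftrightarrow> (g has_derivative D) (at x)"
  using assms(3) has_derivative_transform_within_open[OF _ assms(1,2), of f D UNIV g]
    has_derivative_transform_within_open[OF _ assms(1,2), of g D UNIV f]
  by auto

lemma frechet_derivative_cong_open: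
  assumes "open S" "x \<in> S" "\<And>y. y \<in> S \<Longrightarrow> f y = g y"
  shows "frechet_derivative f (at x) = frechet_derivative g (at x)"
  unfolding frechet_derivative_def
  by (rule arg_cong[where f = Eps], rule ext, rule has_derivative_cong_open) (fact assms)+

lemma differentiable_cong_open:
  assumes "open S" "x \<in> S" "\<And>y. y \<in> S \<Longrightarrow> f y = g y"
  shows "f differentiable (at x) \<longleftrightarrow> g differentiable (at x)"
  unfolding differentiable_def
  by (rule arg_cong[where f = Ex], rule ext, rule has_derivative_cong_open) (fact assms)+

text \<open>Openness matters: a derivative sees a whole neighbourhood of its point, on which the two
  functions must agree.\<close>

lemma Ck_on_cong:
  assumes "open S" "\<And>x. x \<in> S \<Longrightarrow> f x = g x"
  shows "Ck_on k S f \<longleftrightarrow> Ck_on k S g"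
  using assms(2)
proof (induction k arbitrary: f g)
  case 0
  then show ?case
    using continuous_on_cong[of S S f g] by simp
next
  case (Suc k)
  have "Ck_on k S (\<lambda>x. frechet_derivative f (at x) v) \<longleftrightarrow>
      Ck_on k S (\<lambda>x. frechet_derivative g (at x) v)" for v
    by (rule Suc.IH, rule fun_cong[OF frechet_derivative_cong_open[OF assms(1) _ Suc.prems]])
  moreover have "(\<forall>x\<in>S. f differentiable (at x)) \<longleftrightarrow> (\<forall>x\<in>S. g differentiable (at x))"
    by (rule ball_cong[OF refl], rule differentiable_cong_open[OF assms(1) _ Suc.prems])
  ultimately show ?case
    by simp
qed

text \<open>Derivatives are unique, so any explicit formula correct on \<open>S\<close> can stand in
  for \<open>frechet_derivative\<close>. Most closure properties below are inductions on the order
  through this rule.\<close>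

lemma Ck_on_SucI:
  assumes "open S" "\<And>x. x \<in> S \<Longrightarrow> (f has_derivative f' x) (at x)"
    "\<And>v. Ck_on k S (\<lambda>x. f' x v)"
  shows "Ck_on (Suc k) S f"
proof -
  have eq: "frechet_derivative f (at x) v = f' x v" if "x \<in> S" for x v
    using frechet_derivative_at[OF assms(2)[OF that]] by simp
  have "Ck_on k S (\<lambda>x. frechet_derivative f (at x) v)" for v
    by (rule Ck_on_cong[OF assms(1), THEN iffD2, OF _ assms(3)[of v]]) (rule eq)
  then show ?thesis
    using assms(2) by (auto simp: differentiable_def)
qed

lemma Ck_on_SucD:
  assumes "Ck_on (Suc k) S f"
  shows "x \<in> S \<Longrightarrow> (f has_derivative frechet_derivative f (at x)) (at x)"
    and "Ck_on k S (\<lambda>x. frechet_derivative f (at x) v)"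
  using assms by (auto simp: frechet_derivative_works)

lemma Ck_on_Suc_imp: "Ck_on (Suc k) S f \<Longrightarrow> Ck_on k S f"
proof (induction k arbitrary: f)
  case 0
  then show ?case
    by (auto intro!: continuous_at_imp_continuous_on differentiable_imp_continuous_within)
next
  case (Suc k)
  then show ?case
    using Ck_on.simps(2) by blast
qed

lemma Ck_on_subset: "Ck_on k S f \<Longrightarrow> T \<subseteq> S \<Longrightarrow> Ck_on k T f"
  by (induction k arbitrary: f) (auto intro: continuous_on_subset)

lemma Ck_on_open_Un:
  assumes "open S" "open T" "Ck_on k S f" "Ck_on k T f"
  shows "Ck_on k (S \<union> T) f"
  using assms(3,4)
proof (induction k arbitrary: f)
  case 0
  then show ?case
    using assms(1,2) by (auto intro: continuous_on_open_Un)
qed auto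

lemma Ck_on_const: "open S \<Longrightarrow> Ck_on k S (\<lambda>x. c)"
proof (induction k arbitrary: c)
  case (Suc k)
  then show ?case
    by (intro Ck_on_SucI[where f' = "\<lambda>x v. 0"]) auto
qed simp

lemma Ck_on_add:
  assumes "open S" "Ck_on k S f" "Ck_on k S g"
  shows "Ck_on k S (\<lambda>x. f x + g x)"
  using assms(2,3)
proof (induction k arbitrary: f g)
  case 0
  then show ?case
    by (auto intro: continuous_intros)
next
  case (Suc k)
  show ?case
    using assms(1) Suc.IH Ck_on_SucD[OF Suc.prems(1)] Ck_on_SucD[OF Suc.prems(2)]
    by (intro Ck_on_SucI[where
          f' = "\<lambda>x v. frechet_derivative f (at x) v + frechet_derivative g (at x) v"])
      (auto intro: has_derivative_add)
qed

lemma Ck_on_sum: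
  assumes "open S" "\<And>i. i \<in> I \<Longrightarrow> Ck_on k S (f i)"
  shows "Ck_on k S (\<lambda>x. \<Sum>i\<in>I. f i x)"
  using assms
  by (induction I rule: infinite_finite_induct) (auto intro: Ck_on_add Ck_on_const)

lemma Ck_on_bounded_linear:
  assumes "bounded_linear h" "open S" "Ck_on k S f"
  shows "Ck_on k S (\<lambda>x. h (f x))"
  using assms(3)
proof (induction k arbitrary: f)
  case 0
  then show ?case
    using assms(1) by (auto intro: bounded_linear.continuous_on)
next
  case (Suc k)
  show ?case
    using assms(1,2) Suc.IH Ck_on_SucD[OF Suc.prems]
    by (intro Ck_on_SucI[where f' = "\<lambda>x v. h (frechet_derivative f (at x) v)"])
      (auto intro: bounded_linear.has_derivative)
qed

lemma Ck_on_mult: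
  fixes f g :: "'a::real_normed_vector \<Rightarrow> real"
  assumes "open S" "Ck_on k S f" "Ck_on k S g"
  shows "Ck_on k S (\<lambda>x. f x * g x)"
  using assms(2,3)
proof (induction k arbitrary: f g)
  case 0
  then show ?case
    by (auto intro: continuous_intros)
next
  case (Suc k)
  \<comment> \<open>The product rule leaves one factor undifferentiated, so the induction also needs
    \<open>f\<close> and \<open>g\<close> themselves at the lower order.\<close>
  note fg = Ck_on_Suc_imp[OF Suc.prems(1)] Ck_on_Suc_imp[OF Suc.prems(2)]
  show ?case
    using assms(1) Suc.IH Ck_on_SucD[OF Suc.prems(1)] Ck_on_SucD[OF Suc.prems(2)] fg
    by (intro Ck_on_SucI[where f' = "\<lambda>x v. f x * frechet_derivative g (at x) v +
            frechet_derivative f (at x) v * g x"])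
      (auto intro!: has_derivative_mult Ck_on_add)
qed

lemma Ck_on_compose:
  fixes f :: "'a::real_normed_vector \<Rightarrow> 'b::euclidean_space" and g :: "'b \<Rightarrow> real"
  assumes "open S" "open T" "f ` S \<subseteq> T" "Ck_on k S f" "Ck_on k T g"
  shows "Ck_on k S (\<lambda>x. g (f x))"
  using assms(4,5)
proof (induction k arbitrary: g)
  case 0
  then show ?case
    using assms(3) by (auto intro: continuous_on_compose2)
next
  case (Suc k)
  let ?f' = "\<lambda>x. frechet_derivative f (at x)" and ?g' = "\<lambda>y. frechet_derivative g (at y)"
  have deriv: "((\<lambda>x. g (f x)) has_derivative (\<lambda>v. ?g' (f x) (?f' x v))) (at x)"
    if "x \<in> S" for x
    using has_derivative_compose[OF Ck_on_SucD(1)[OF Suc.prems(1) that]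
        Ck_on_SucD(1)[OF Suc.prems(2), of "f x"]] assms(3) that
    by auto
  \<comment> \<open>\<open>Ck_on\<close> controls derivatives in a fixed direction only, whereas
    \<open>?f' x v\<close> moves with \<open>x\<close>. Expanding it in the basis leaves derivatives
    of \<open>g\<close> in fixed directions, to which the induction hypothesis applies.\<close>
  have expand: "(\<Sum>b\<in>Basis. (?f' x v \<bullet> b) * ?g' (f x) b) = ?g' (f x) (?f' x v)"
    if "x \<in> S" for x v
  proof -
    have "linear (?g' (f x))"
      using Ck_on_SucD(1)[OF Suc.prems(2), of "f x"] assms(3) that
      by (auto intro: has_derivative_linear)
    then have "?g' (f x) (\<Sum>b\<in>Basis. (?f' x v \<bullet> b) *\<^sub>R b) =
        (\<Sum>b\<in>Basis. (?f' x v \<bullet> b) * ?g' (f x) b)"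
      by (simp add: linear_sum linear_cmul)
    then show ?thesis
      by (simp add: euclidean_representation)
  qed
  have sum: "Ck_on k S (\<lambda>x. \<Sum>b\<in>Basis. (?f' x v \<bullet> b) * ?g' (f x) b)" for v
    using Suc.IH[OF Ck_on_Suc_imp[OF Suc.prems(1)]] Ck_on_SucD(2)[OF Suc.prems(1)]
      Ck_on_SucD(2)[OF Suc.prems(2)] assms(1)
    by (intro Ck_on_sum Ck_on_mult Ck_on_bounded_linear[OF bounded_linear_inner_left]) auto
  have "Ck_on k S (\<lambda>x. ?g' (f x) (?f' x v))" for v
    by (rule Ck_on_cong[OF assms(1), THEN iffD1, OF _ sum[of v]]) (rule expand)
  then show ?case
    using Ck_on_SucI[OF assms(1) deriv] by blast
qed

section \<open>Passage from finite order to smoothness\<close>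

lemma smooth_on_cong:
  "open S \<Longrightarrow> (\<And>x. x \<in> S \<Longrightarrow> f x = g x) \<Longrightarrow> smooth_on S f \<longleftrightarrow> smooth_on S g"
  unfolding smooth_on_def using Ck_on_cong by blast

lemma smooth_on_differentiable: "smooth_on S f \<Longrightarrow> x \<in> S \<Longrightarrow> f differentiable (at x)"
  unfolding smooth_on_def by (metis Ck_on.simps(2))

lemma smooth_on_derivative:
  "smooth_on S f \<Longrightarrow> smooth_on S (\<lambda>x. frechet_derivative f (at x) v)"
  unfolding smooth_on_def by (metis Ck_on.simps(2))

lemma smooth_on_compose:
  fixes f :: "'a::real_normed_vector \<Rightarrow> 'b::euclidean_space" and g :: "'b \<Rightarrow> real"
  assumes "open S" "open T" "f ` S \<subseteq> T" "smooth_on S f" "smooth_on T g"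
  shows "smooth_on S (\<lambda>x. g (f x))"
  using assms Ck_on_compose unfolding smooth_on_def by blast

lemma smooth_on_const: "open S \<Longrightarrow> smooth_on S (\<lambda>x. c)"
  using Ck_on_const unfolding smooth_on_def by blast

lemma smooth_on_add:
  "open S \<Longrightarrow> smooth_on S f \<Longrightarrow> smooth_on S g \<Longrightarrow> smooth_on S (\<lambda>x. f x + g x)"
  using Ck_on_add unfolding smooth_on_def by blast

lemma smooth_on_mult:
  fixes f g :: "'a::real_normed_vector \<Rightarrow> real"
  shows "open S \<Longrightarrow> smooth_on S f \<Longrightarrow> smooth_on S g \<Longrightarrow> smooth_on S (\<lambda>x. f x * g x)"
  using Ck_on_mult unfolding smooth_on_def by blast


section \<open>A smooth bump\<close>

text \<open>The exponent \<open>k\<close> makes the family closed under differentiation up to linear combinations.\<close>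

definition flat_exp :: "nat \<Rightarrow> real \<Rightarrow> real" where
  "flat_exp k t = (if t > 0 then inverse t ^ k * exp (- inverse t) else 0)"

text \<open>With \<open>s = inverse t\<close>, the limit from the right is the decay of
  \<open>s ^ k * exp (- s)\<close> at infinity; to the left of 0 the function vanishes.\<close>

lemma flat_exp_tendsto_0: "(flat_exp k \<longlongrightarrow> 0) (at 0)"
proof -
  have "((\<lambda>s::real. s ^ k * exp (- s)) \<longlongrightarrow> 0) at_top"
    using tendsto_power_div_exp_0[of k] by (simp add: exp_minus divide_inverse)
  then have "((\<lambda>t::real. inverse t ^ k * exp (- inverse t)) \<longlongrightarrow> 0) (at_right 0)"
    using filterlim_compose filterlim_inverse_at_top_right by blast
  then have "(flat_exp k \<longlongrightarrow> 0) (at_right 0)"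
    by (rule Lim_transform_eventually)
      (auto simp: flat_exp_def eventually_at_filter)
  moreover have "(flat_exp k \<longlongrightarrow> 0) (at_left 0)"
    by (rule Lim_transform_eventually[OF tendsto_const])
      (auto simp: flat_exp_def eventually_at_filter)
  ultimately show ?thesis
    by (simp add: filterlim_at_split)
qed

lemma flat_exp_has_derivative:
  "(flat_exp k has_real_derivative flat_exp (k + 2) t - real k * flat_exp (k + 1) t) (at t)"
proof -
  consider "t > 0" | "t < 0" | "t = 0"
    by linarith
  then show ?thesis
  proof cases
    case 1
    have "((\<lambda>t. inverse t ^ k) has_real_derivative - real k * inverse t ^ (k + 1)) (at t)"
      using DERIV_power[OF DERIV_inverse, of t k] 1 by (cases k) (simp_all add: algebra_simps)
    moreover have "((\<lambda>t. exp (- inverse t)) has_real_derivative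
        exp (- inverse t) * inverse t ^ 2) (at t)"
      using 1 by (auto intro!: derivative_eq_intros simp: power2_eq_square)
    ultimately have "((\<lambda>t. inverse t ^ k * exp (- inverse t)) has_real_derivative
        flat_exp (k + 2) t - real k * flat_exp (k + 1) t) (at t)"
      using 1 DERIV_mult
      by (fastforce simp: flat_exp_def algebra_simps power2_eq_square)
    then show ?thesis
      by (rule has_field_derivative_transform_within_open[where S = "{0<..}"])
        (use 1 in \<open>auto simp: flat_exp_def\<close>)
  next
    case 2
    have "((\<lambda>t. 0) has_real_derivative flat_exp (k + 2) t - real k * flat_exp (k + 1) t) (at t)"
      using 2 by (simp add: flat_exp_def)
    then show ?thesis
      by (rule has_field_derivative_transform_within_open[where S = "{..<0}"])
        (use 2 in \<open>auto simp: flat_exp_def\<close>)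
  next
    case 3
    \<comment> \<open>At 0 the difference quotient is the next member of the family, which tends to
      0; the claimed derivative is 0 there too.\<close>
    have "(flat_exp k h - flat_exp k 0) / h = flat_exp (k + 1) h" for h
      by (simp add: flat_exp_def field_simps)
    then show ?thesis
      using 3 flat_exp_tendsto_0[of "k + 1"] unfolding DERIV_def
      by (simp add: flat_exp_def[of _ 0])
  qed
qed

lemma Ck_on_flat_exp: "Ck_on j UNIV (flat_exp k)"
proof (induction j arbitrary: k)
  case 0
  have "isCont (flat_exp k) t" for t
    using flat_exp_has_derivative DERIV_isCont by blast
  then show ?case
    by (simp add: continuous_on_eq_continuous_at)
next
  case (Suc j)
  have "Ck_on j UNIV (\<lambda>t. (flat_exp (k + 2) t + (- real k) * flat_exp (k + 1) t) * v)" for v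
    using Suc by (intro Ck_on_mult Ck_on_add Ck_on_const) auto
  moreover have "(flat_exp k has_derivative
      (\<lambda>v. (flat_exp (k + 2) t + (- real k) * flat_exp (k + 1) t) * v)) (at t)" for t
    using flat_exp_has_derivative[of k t] by (simp add: has_field_derivative_def)
  ultimately show ?case
    by (intro Ck_on_SucI) auto
qed

lemma Ck_on_ident: "open S \<Longrightarrow> Ck_on k S (\<lambda>x. x)"
  by (cases k) (auto intro!: Ck_on_SucI[where f' = "\<lambda>x v. v"] Ck_on_const)

lemma Ck_on_norm_square:
  fixes c :: "'a::euclidean_space"
  shows "Ck_on k UNIV (\<lambda>x. (x - c) \<bullet> (x - c))"
proof -
  have "Ck_on k UNIV (\<lambda>x. x + - c)"
    by (intro Ck_on_add Ck_on_ident Ck_on_const) auto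
  then have "Ck_on k UNIV (\<lambda>x. (x - c) \<bullet> b)" for b
    using Ck_on_bounded_linear[OF bounded_linear_inner_left, of UNIV k "\<lambda>x. x + - c" b] by simp
  then have "Ck_on k UNIV (\<lambda>x. \<Sum>b\<in>Basis. ((x - c) \<bullet> b) * ((x - c) \<bullet> b))"
    by (intro Ck_on_sum Ck_on_mult) auto
  then show ?thesis
    by (simp only: euclidean_inner[symmetric])
qed

text \<open>The bump is \<open>flat_exp 0\<close> applied to r^2 - |x - c|^2, which is negative off
  the ball. The value and a directional derivative must be nonzero at the same point because their
  product is what gets used on the manifold.\<close>

lemma smooth_bump:
  fixes c :: "'a::euclidean_space" and r :: real
  assumes "r > 0"
  obtains \<beta> :: "'a \<Rightarrow> real" and x e where "smooth_on UNIV \<beta>" "\<forall>y. y \<notin> cball c r \<longrightarrow> \<beta> y = 0"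
    "x \<in> cball c r" "\<beta> x \<noteq> 0" "frechet_derivative \<beta> (at x) e \<noteq> 0"
proof -
  \<comment> \<open>The point \<open>c + e\<close> lies halfway to the sphere: at the centre the
    gradient vanishes, on the sphere the bump does. The same \<open>e\<close> is the radial
    direction of differentiation.\<close>
  obtain e :: 'a where e: "norm e = r / 2"
    by (rule vector_choose_size[of "r / 2"]) (use assms in auto)
  define q where "q x = r\<^sup>2 - (x - c) \<bullet> (x - c)" for x
  define \<beta> where "\<beta> x = flat_exp 0 (q x)" for x
  have "Ck_on k UNIV (\<lambda>x. r\<^sup>2 + (-1) * ((x - c) \<bullet> (x - c)))" for k
    by (rule Ck_on_add[OF open_UNIV Ck_on_const[OF open_UNIV]
          Ck_on_mult[OF open_UNIV Ck_on_const[OF open_UNIV] Ck_on_norm_square]])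
  moreover have "(\<lambda>x. r\<^sup>2 + (-1) * ((x - c) \<bullet> (x - c))) = q"
    by (rule ext) (simp add: q_def)
  ultimately have "Ck_on k UNIV q" for k
    by simp
  then have smooth: "smooth_on UNIV \<beta>"
    unfolding \<beta>_def[abs_def] smooth_on_def
    using Ck_on_compose[of UNIV UNIV q _ "flat_exp 0"] Ck_on_flat_exp by blast
  have outside: "\<beta> y = 0" if "y \<notin> cball c r" for y
  proof -
    have "norm (y - c) > r"
      using that by (simp add: dist_norm norm_minus_commute)
    then have "q y < 0"
      using assms power_strict_mono[of r "norm (y - c)" 2]
      by (simp add: q_def power2_norm_eq_inner)
    then show ?thesis
      by (simp add: \<beta>_def flat_exp_def)
  qed
  have ee: "e \<bullet> e = r\<^sup>2 / 4"
    unfolding power2_norm_eq_inner[symmetric] e by (simp add: power_divide)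
  have q: "q (c + e) > 0"
    using assms by (simp add: q_def ee)
  have "(q has_derivative (\<lambda>v. - (2 * (e \<bullet> v)))) (at (c + e))"
    unfolding q_def[abs_def]
    by (auto intro!: derivative_eq_intros simp: inner_commute)
  moreover have "(flat_exp 0 has_derivative (*) (flat_exp 2 (q (c + e)))) (at (q (c + e)))"
    using flat_exp_has_derivative[of 0 "q (c + e)"]
    by (simp add: has_field_derivative_def numeral_2_eq_2)
  ultimately have "(\<beta> has_derivative (\<lambda>v. flat_exp 2 (q (c + e)) * - (2 * (e \<bullet> v)))) (at (c + e))"
    unfolding \<beta>_def[abs_def] by (rule has_derivative_compose)
  then have "frechet_derivative \<beta> (at (c + e)) e = flat_exp 2 (q (c + e)) * - (2 * (e \<bullet> e))"
    by (metis frechet_derivative_at)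
  moreover have "e \<bullet> e \<noteq> 0"
    unfolding ee using assms by simp
  moreover have "c + e \<in> cball c r"
    using e assms by (simp add: dist_norm)
  moreover have "\<beta> (c + e) \<noteq> 0"
    using q by (simp add: \<beta>_def flat_exp_def)
  ultimately show ?thesis
    using that[OF smooth, of "c + e" e] outside q by (simp add: flat_exp_def)
qed


section \<open>Functions and fields on a manifold\<close>

lemma scaleR_fun_apply: "(c *\<^sub>R f) x = c *\<^sub>R f x"
  by (simp add: scaleR_fun_def)

locale smooth_manifold =
  fixes A :: "('m::{t2_space, second_countable_topology}, 'n::finite) chart set"
  assumes atlas: "smooth_atlas A"
begin

lemma chart_props:
  assumes "(U, \<phi>) \<in> A"
  shows open_chart: "open U" and open_image: "open (\<phi> ` U)"
    and homeo_chart: "homeomorphism U (\<phi> ` U) \<phi> (inv_into U \<phi>)"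
    and inj_chart: "inj_on \<phi> U"
proof -
  show "open U" "open (\<phi> ` U)" and h: "homeomorphism U (\<phi> ` U) \<phi> (inv_into U \<phi>)"
    using atlas assms by (auto simp: smooth_atlas_def)
  show "inj_on \<phi> U"
    using h by (metis homeomorphism_def inj_on_inverseI)
qed

section \<open>The algebra of smooth functions and extension by zero\<close>

lemma smooth_functions_iff:
  "f \<in> smooth_functions A \<longleftrightarrow>
    (\<forall>U \<phi>. (U, \<phi>) \<in> A \<longrightarrow> smooth_on (\<phi> ` U) (\<lambda>x. f (inv_into U \<phi> x)))"
  by (auto simp: smooth_functions_def o_def)

lemma smooth_functions_add:
  assumes "f \<in> smooth_functions A" "g \<in> smooth_functions A"
  shows "(\<lambda>p. f p + g p) \<in> smooth_functions A"
  using assms unfolding smooth_functions_iff by (auto intro!: smooth_on_add intro: open_image)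

lemma smooth_functions_mult:
  assumes "f \<in> smooth_functions A" "g \<in> smooth_functions A"
  shows "(\<lambda>p. f p * g p) \<in> smooth_functions A"
  using assms unfolding smooth_functions_iff by (auto intro!: smooth_on_mult intro: open_image)

lemma smooth_functions_const: "(\<lambda>p. c) \<in> smooth_functions A"
  unfolding smooth_functions_iff by (auto intro!: smooth_on_const intro: open_image)

lemma smooth_functions_cmult: "f \<in> smooth_functions A \<Longrightarrow> (\<lambda>p. c * f p) \<in> smooth_functions A"
  using smooth_functions_mult smooth_functions_const by blast

lemma smooth_functions_diff:
  assumes "f \<in> smooth_functions A" "g \<in> smooth_functions A"
  shows "(\<lambda>p. f p - g p) \<in> smooth_functions A"
  using smooth_functions_add[OF assms(1) smooth_functions_cmult[OF assms(2), of "-1"]] by simp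

text \<open>The copy of \<open>K\<close> in the manifold is compact, hence closed in a Hausdorff
  space, so its complement and \<open>U\<close> form an open cover. On \<open>U\<close> the function
  is \<open>h\<close> read through the chart, on the complement it is 0.\<close>

lemma smooth_functions_extend:
  assumes chart: "(U, \<phi>) \<in> A" and K: "compact K" "K \<subseteq> \<phi> ` U"
    and h: "smooth_on (\<phi> ` U) h" "\<And>x. x \<notin> K \<Longrightarrow> h x = 0"
  shows "(\<lambda>q. if q \<in> U then h (\<phi> q) else 0) \<in> smooth_functions A"
    (is "?f \<in> _")
proof -
  let ?K = "inv_into U \<phi> ` K"
  have "continuous_on K (inv_into U \<phi>)"
    using homeo_chart[OF chart] K(2) continuous_on_subset by (auto simp: homeomorphism_def)
  then have closed: "closed ?K"
    using K(1) compact_continuous_image compact_imp_closed by blast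
  have zero: "?f q = 0" if "q \<notin> ?K" for q
    using that h(2) inj_chart[OF chart] by (force simp: image_iff)
  have "smooth_on (\<psi> ` V) (?f \<circ> inv_into V \<psi>)" if V: "(V, \<psi>) \<in> A" for V \<psi>
  proof -
    let ?i = "inv_into V \<psi>"
    have inv: "?i (\<psi> q) = q" if "q \<in> V" for q
      using inj_chart[OF V] that by simp
    have open_sub: "open (\<psi> ` (V \<inter> W))" if "open W" for W
    proof -
      have "openin (top_of_set V) (V \<inter> W)"
        using that by auto
      then have "openin (top_of_set (\<psi> ` V)) (\<psi> ` (V \<inter> W))"
        using homeo_chart[OF V] homeomorphism_imp_open_map by blast
      then show ?thesis
        using open_image[OF V] openin_open_trans by blast
    qed
    have U: "open (\<psi> ` (V \<inter> U))" and C: "open (\<psi> ` (V \<inter> - ?K))"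
      using open_sub open_chart[OF chart] closed by auto
    \<comment> \<open>\<open>h\<close> is smooth in the coordinates of \<open>\<phi>\<close>; the
      transition map carries this over to those of \<open>\<psi>\<close>.\<close>
    have "smooth_on (\<psi> ` (V \<inter> U)) (\<phi> \<circ> ?i)"
      using atlas chart V unfolding smooth_atlas_def by blast
    moreover have "(\<phi> \<circ> ?i) ` \<psi> ` (V \<inter> U) \<subseteq> \<phi> ` U"
      using inv by auto
    ultimately have "smooth_on (\<psi> ` (V \<inter> U)) (\<lambda>x. h ((\<phi> \<circ> ?i) x))"
      using smooth_on_compose[OF U open_image[OF chart] _ _ h(1), of "\<phi> \<circ> ?i"] by blast
    then have 1: "smooth_on (\<psi> ` (V \<inter> U)) (?f \<circ> ?i)"
      using inv by (subst smooth_on_cong[OF U, where g = "\<lambda>x. h ((\<phi> \<circ> ?i) x)"]) auto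
    have "smooth_on (\<psi> ` (V \<inter> - ?K)) (\<lambda>x. 0 :: real)"
      unfolding smooth_on_def using Ck_on_const[OF C] by blast
    then have 2: "smooth_on (\<psi> ` (V \<inter> - ?K)) (?f \<circ> ?i)"
      by (rule smooth_on_cong[OF C, THEN iffD2, rotated])
        (use zero in \<open>auto simp only: inv o_apply image_iff\<close>)
    have "?K \<subseteq> U"
      using K(2) by (auto intro: inv_into_into)
    then have "\<psi> ` V = \<psi> ` (V \<inter> U) \<union> \<psi> ` (V \<inter> - ?K)"
      by blast
    then show ?thesis
      using 1 2 Ck_on_open_Un[OF U C] unfolding smooth_on_def by metis
  qed
  then show ?thesis
    by (auto simp: smooth_functions_def)
qed

section \<open>Pointwise algebra of tangent vectors and covectors\<close>

lemma tangent_space_apply: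
  assumes "v \<in> tangent_space A p" "f \<in> smooth_functions A" "g \<in> smooth_functions A"
  shows tangent_add: "v (\<lambda>q. f q + g q) = v f + v g"
    and tangent_mult: "v (\<lambda>q. f q * g q) = f p * v g + g p * v f"
  using assms by (auto simp: tangent_space_def linear_map_on_def plus_fun_def times_fun_def)

lemma tangent_cmult:
  assumes "v \<in> tangent_space A p" "f \<in> smooth_functions A"
  shows "v (\<lambda>q. c * f q) = c * v f"
  using assms by (auto simp: tangent_space_def linear_map_on_def scaleR_fun_def)

lemma tangent_diff:
  assumes "v \<in> tangent_space A p" "f \<in> smooth_functions A" "g \<in> smooth_functions A"
  shows "v (\<lambda>q. f q - g q) = v f - v g"
  using tangent_add[OF assms(1,2) smooth_functions_cmult[OF assms(3), of "-1"]]
    tangent_cmult[OF assms(1,3), of "-1"]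
  by simp

lemma tangent_zero: "v \<in> tangent_space A p \<Longrightarrow> v (\<lambda>q. 0) = 0"
  using tangent_cmult[of v p "\<lambda>q. 0" 0] smooth_functions_const by simp

lemma tangent_nonsmooth: "v \<in> tangent_space A p \<Longrightarrow> f \<notin> smooth_functions A \<Longrightarrow> v f = 0"
  by (simp add: tangent_space_def)

lemma tangent_spaceI:
  assumes "\<And>f g. f \<in> smooth_functions A \<Longrightarrow> g \<in> smooth_functions A \<Longrightarrow>
      v (\<lambda>q. f q + g q) = v f + v g"
    and "\<And>f g. f \<in> smooth_functions A \<Longrightarrow> g \<in> smooth_functions A \<Longrightarrow>
      v (\<lambda>q. f q * g q) = f p * v g + g p * v f"
    and "\<And>c f. f \<in> smooth_functions A \<Longrightarrow> v (\<lambda>q. c * f q) = c * v f"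
    and "\<And>f. f \<notin> smooth_functions A \<Longrightarrow> v f = 0"
  shows "v \<in> tangent_space A p"
  using assms
  by (simp add: tangent_space_def linear_map_on_def plus_fun_def times_fun_def scaleR_fun_def)

lemma tangent_space_subspace:
  assumes "v \<in> tangent_space A p"
  shows tangent_space_scaleR: "c *\<^sub>R v \<in> tangent_space A p"
    and tangent_space_plus: "w \<in> tangent_space A p \<Longrightarrow> v + w \<in> tangent_space A p"
  using assms
  by (auto intro!: tangent_spaceI
      simp: scaleR_fun_def tangent_add tangent_mult tangent_cmult tangent_nonsmooth algebra_simps)

lemma cotangent_space_apply:
  assumes "\<xi> \<in> cotangent_space A p" "v \<in> tangent_space A p"
  shows cotangent_plus: "w \<in> tangent_space A p \<Longrightarrow> \<xi> (v + w) = \<xi> v + \<xi> w"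
    and cotangent_scaleR: "\<xi> (c *\<^sub>R v) = c * \<xi> v"
  using assms by (auto simp: cotangent_space_def linear_map_on_def)

lemma cotangent_minus:
  assumes "\<xi> \<in> cotangent_space A p" "v \<in> tangent_space A p" "w \<in> tangent_space A p"
  shows "\<xi> (v - w) = \<xi> v - \<xi> w"
  using cotangent_plus[OF assms(1,2) tangent_space_scaleR[OF assms(3), of "-1"]]
    cotangent_scaleR[OF assms(1,3), of "-1"]
  by simp

section \<open>Vector fields, one-forms and generalized sections\<close>

lemma vector_field_tangent: "X \<in> vector_fields A \<Longrightarrow> X p \<in> tangent_space A p"
  by (simp add: vector_fields_def)

text \<open>Tangent vectors are 0 on nonsmooth functions by convention, so \<open>f\<close> may be
  arbitrary and later rewriting carries no side condition on it.\<close>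

lemma vector_field_smooth:
  assumes "X \<in> vector_fields A"
  shows "(\<lambda>q. X q f) \<in> smooth_functions A"
proof (cases "f \<in> smooth_functions A")
  case False
  then have "(\<lambda>q. X q f) = (\<lambda>q. 0)"
    using tangent_nonsmooth vector_field_tangent[OF assms] by blast
  then show ?thesis
    by (simp add: smooth_functions_const)
qed (use assms in \<open>simp add: vector_fields_def\<close>)

lemma one_form_cotangent: "\<xi> \<in> one_forms A \<Longrightarrow> \<xi> p \<in> cotangent_space A p"
  by (simp add: one_forms_def)

lemma one_form_smooth:
  "\<xi> \<in> one_forms A \<Longrightarrow> X \<in> vector_fields A \<Longrightarrow> (\<lambda>q. \<xi> q (X q)) \<in> smooth_functions A"
  by (simp add: one_forms_def)

lemma vector_field_scale:
  assumes "f \<in> smooth_functions A" "X \<in> vector_fields A"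
  shows "(\<lambda>q. f q *\<^sub>R X q) \<in> vector_fields A"
  using assms tangent_space_scaleR smooth_functions_mult vector_field_smooth[OF assms(2)]
  by (auto simp: vector_fields_def scaleR_fun_def)

lemma one_form_scale:
  assumes "f \<in> smooth_functions A" "\<xi> \<in> one_forms A"
  shows "(\<lambda>q. f q *\<^sub>R \<xi> q) \<in> one_forms A"
proof -
  have "f p *\<^sub>R \<xi> p \<in> cotangent_space A p" for p
    using one_form_cotangent[OF assms(2), of p]
    by (auto simp: cotangent_space_def linear_map_on_def scaleR_fun_def algebra_simps)
  then show ?thesis
    using smooth_functions_mult[OF assms(1)] one_form_smooth[OF assms(2)]
    by (auto simp: one_forms_def scaleR_fun_def)
qed

lemma differential_one_form:
  assumes "f \<in> smooth_functions A"
  shows "differential A f \<in> one_forms A"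
proof -
  have "differential A f p \<in> cotangent_space A p" for p
    by (auto simp: cotangent_space_def linear_map_on_def differential_def
        tangent_space_plus tangent_space_scaleR scaleR_fun_apply)
  moreover have "(\<lambda>q. differential A f q (X q)) = (\<lambda>q. X q f)" if "X \<in> vector_fields A" for X
    using vector_field_tangent[OF that] by (auto simp: differential_def)
  ultimately show ?thesis
    using vector_field_smooth by (auto simp: one_forms_def)
qed

lemma gen_section_scale:
  assumes "f \<in> smooth_functions A" "a \<in> gen_sections A"
  shows "(\<lambda>q. f q *\<^sub>R a q) \<in> gen_sections A"
  using assms vector_field_scale one_form_scale by (auto simp: gen_sections_def)

lemma gen_section_mem: "a \<in> gen_sections A \<Longrightarrow> a p \<in> gen_space A p"
  by (auto simp: gen_sections_def gen_space_def mem_Times_iff vector_fields_def one_forms_def)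


section \<open>The Courant bracket of a section and a multiple of a section\<close>

text \<open>In the Leibniz rule the mixed products such as \<open>X p f * Y p g\<close> occur in
  both iterated derivatives and cancel. On a nonsmooth function the inner derivative is identically
  0, which gives the default value.\<close>

lemma lie_bracket_tangent:
  assumes "X \<in> vector_fields A" "Y \<in> vector_fields A"
  shows "lie_bracket X Y p \<in> tangent_space A p"
proof -
  note X = vector_field_tangent[OF assms(1)] and Y = vector_field_tangent[OF assms(2)]
  note [simp] = vector_field_smooth[OF assms(1)] vector_field_smooth[OF assms(2)]
    smooth_functions_mult
  show ?thesis
    by (rule tangent_spaceI)
      (simp_all add: lie_bracket_def tangent_add[OF X] tangent_add[OF Y] tangent_mult[OF X]
        tangent_mult[OF Y] tangent_cmult[OF X] tangent_cmult[OF Y] tangent_nonsmooth[OF X]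
        tangent_nonsmooth[OF Y] tangent_zero[OF X] tangent_zero[OF Y] algebra_simps)
qed

lemma lie_bracket_scale:
  assumes "X \<in> vector_fields A" "Y \<in> vector_fields A" "f \<in> smooth_functions A"
  shows lie_bracket_scale_right: "lie_bracket X (\<lambda>q. f q *\<^sub>R Y q) p =
      f p *\<^sub>R lie_bracket X Y p + X p f *\<^sub>R Y p"
    and lie_bracket_scale_left: "lie_bracket (\<lambda>q. f q *\<^sub>R X q) Y p =
      f p *\<^sub>R lie_bracket X Y p - Y p f *\<^sub>R X p"
  using tangent_mult[OF vector_field_tangent[OF assms(1)] assms(3) vector_field_smooth[OF assms(2)]]
    tangent_mult[OF vector_field_tangent[OF assms(2)] assms(3) vector_field_smooth[OF assms(1)]]
  by (auto simp: lie_bracket_def fun_eq_iff scaleR_fun_apply algebra_simps)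

text \<open>The choice inside \<open>lie_derivative\<close> depends only on \<open>p\<close> and the
  vector, so a single \<open>Z\<close> serves all \<open>X\<close> and \<open>\<eta>\<close>;
  \<open>W\<close> shows that a choice exists. \<open>Z\<close> may differ from \<open>W\<close>
  away from \<open>p\<close>.\<close>

lemma lie_derivative_extension:
  assumes "W \<in> vector_fields A"
  obtains Z where "Z \<in> vector_fields A" "Z p = W p"
    "\<And>X \<eta>. lie_derivative A X \<eta> p (W p) = X p (\<lambda>q. \<eta> q (Z q)) - \<eta> p (lie_bracket X Z p)"
proof -
  define Z where "Z = (SOME Y. Y \<in> vector_fields A \<and> Y p = W p)"
  have "Z \<in> vector_fields A \<and> Z p = W p"
    unfolding Z_def by (rule someI[of _ W]) (use assms in simp)
  moreover have "lie_derivative A X \<eta> p (W p) = X p (\<lambda>q. \<eta> q (Z q)) - \<eta> p (lie_bracket X Z p)"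
    for X \<eta>
    using vector_field_tangent[OF assms, of p]
    by (simp add: lie_derivative_def Let_def Z_def)
  ultimately show ?thesis
    using that by blast
qed

text \<open>Brackets are only ever paired with values of global sections. This avoids showing that every
  tangent vector extends to a vector field, without which \<^const>\<open>lie_derivative\<close> is not known to
  be meaningful.\<close>

lemma courant_bracket_scale:
  assumes "a \<in> gen_sections A" "b \<in> gen_sections A" "w \<in> gen_sections A"
    and f: "f \<in> smooth_functions A"
  shows "g_can (courant_bracket A a (\<lambda>q. f q *\<^sub>R b q) p) (w p) =
    f p * g_can (courant_bracket A a b p) (w p) + fst (a p) f * g_can (b p) (w p) -
    g_can (a p) (b p) * fst (w p) f / 2"
proof -
  define X Y W where "X q = fst (a q)" "Y q = fst (b q)" "W q = fst (w q)" for q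
  define \<xi> \<eta> \<zeta> where "\<xi> q = snd (a q)" "\<eta> q = snd (b q)" "\<zeta> q = snd (w q)" for q
  note defs = X_Y_W_def \<xi>_\<eta>_\<zeta>_def
  have X: "X \<in> vector_fields A" and Y: "Y \<in> vector_fields A" and W: "W \<in> vector_fields A"
    and \<xi>: "\<xi> \<in> one_forms A" and \<eta>: "\<eta> \<in> one_forms A" and \<zeta>: "\<zeta> \<in> one_forms A"
    using assms(1-3) by (simp_all add: gen_sections_def defs[abs_def])
  have fY: "(\<lambda>q. f q *\<^sub>R Y q) \<in> vector_fields A"
    using f Y by (rule vector_field_scale)
  obtain Z where Z: "Z \<in> vector_fields A" and ZW: "Z p = W p"
    and lie: "\<And>X \<eta>. lie_derivative A X \<eta> p (W p) =
      X p (\<lambda>q. \<eta> q (Z q)) - \<eta> p (lie_bracket X Z p)"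
    using lie_derivative_extension[OF W, of p] by metis
  note X' = vector_field_tangent[OF X, of p] and Y' = vector_field_tangent[OF Y, of p]
    and W' = vector_field_tangent[OF W, of p]
    and \<xi>' = one_form_cotangent[OF \<xi>, of p] and \<eta>' = one_form_cotangent[OF \<eta>, of p]
    and \<zeta>' = one_form_cotangent[OF \<zeta>, of p]
  have scaled_eval: "\<xi> q (f q *\<^sub>R Y q) = f q * \<xi> q (Y q)" for q
    using one_form_cotangent[OF \<xi>] vector_field_tangent[OF Y] by (rule cotangent_scaleR)
  have 1: "lie_derivative A X (\<lambda>q. f q *\<^sub>R \<eta> q) p (W p) =
      f p * lie_derivative A X \<eta> p (W p) + X p f * \<eta> p (W p)"
    using tangent_mult[OF X' f one_form_smooth[OF \<eta> Z]]
    by (simp add: lie scaleR_fun_apply ZW algebra_simps)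
  \<comment> \<open>The derivative of \<open>f\<close> enters through [fY, Z] = f [Y, Z] - Z(f) Y,
    and at \<open>p\<close> the vector \<open>Z p\<close> is \<open>W p\<close>.\<close>
  have 2: "lie_derivative A (\<lambda>q. f q *\<^sub>R Y q) \<xi> p (W p) =
      f p * lie_derivative A Y \<xi> p (W p) + W p f * \<xi> p (Y p)"
    using lie_bracket_tangent[OF Y Z, of p] Y'
    by (simp add: lie lie_bracket_scale_left[OF Y Z f] ZW cotangent_minus[OF \<xi>']
        cotangent_scaleR[OF \<xi>'] tangent_space_scaleR)
      (simp add: scaleR_fun_apply algebra_simps)
  have 3: "W p (\<lambda>q. \<xi> q (f q *\<^sub>R Y q) - f q * \<eta> q (X q)) =
      f p * W p (\<lambda>q. \<xi> q (Y q) - \<eta> q (X q)) + (\<xi> p (Y p) - \<eta> p (X p)) * W p f"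
    using tangent_mult[OF W' f
        smooth_functions_diff[OF one_form_smooth[OF \<xi> Y] one_form_smooth[OF \<eta> X]]]
    by (simp add: scaled_eval algebra_simps)
  have 4: "\<zeta> p (lie_bracket X (\<lambda>q. f q *\<^sub>R Y q) p) =
      f p * \<zeta> p (lie_bracket X Y p) + X p f * \<zeta> p (Y p)"
    using lie_bracket_tangent[OF X Y, of p] Y'
    by (simp add: lie_bracket_scale_right[OF X Y f] cotangent_plus[OF \<zeta>']
        cotangent_scaleR[OF \<zeta>'] tangent_space_scaleR)
  \<comment> \<open>The coefficients of \<open>W p f\<close> add up to -\<xi>(Y) + (\<xi>(Y) -
    \<eta>(X))/2 = -(\<xi>(Y) + \<eta>(X))/2, which is minus the pairing of \<open>a\<close> and
    \<open>b\<close>. The outer \<open>g_can\<close> contributes the remaining factor 1/2.\<close>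
  show ?thesis
    using 1 2 3 4 W'
    by (simp add: g_can_def courant_bracket_def Let_def case_prod_unfold defs[symmetric]
        differential_def scaleR_fun_apply)
      (simp add: scaleR_fun_apply field_simps)
qed

text \<open>The Lie derivatives trade places, and linearity of \<open>\<zeta> p\<close> and
  \<open>W p\<close> passes the sign through the other terms. This removes the brackets without a
  factor \<open>f\<close> in the final computation.\<close>

lemma courant_bracket_antisym:
  assumes "a \<in> gen_sections A" "b \<in> gen_sections A" "w \<in> gen_sections A"
  shows "g_can (courant_bracket A a b p) (w p) = - g_can (courant_bracket A b a p) (w p)"
proof -
  define X Y W where "X q = fst (a q)" "Y q = fst (b q)" "W q = fst (w q)" for q
  define \<xi> \<eta> \<zeta> where "\<xi> q = snd (a q)" "\<eta> q = snd (b q)" "\<zeta> q = snd (w q)" for q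
  note defs = X_Y_W_def \<xi>_\<eta>_\<zeta>_def
  have X: "X \<in> vector_fields A" and Y: "Y \<in> vector_fields A" and W: "W \<in> vector_fields A"
    and \<xi>: "\<xi> \<in> one_forms A" and \<eta>: "\<eta> \<in> one_forms A" and \<zeta>: "\<zeta> \<in> one_forms A"
    using assms by (simp_all add: gen_sections_def defs[abs_def])
  note W' = vector_field_tangent[OF W, of p] and \<zeta>' = one_form_cotangent[OF \<zeta>, of p]
  have "lie_bracket X Y p = (-1) *\<^sub>R lie_bracket Y X p"
    by (auto simp: lie_bracket_def fun_eq_iff scaleR_fun_apply)
  then have 1: "\<zeta> p (lie_bracket X Y p) = - \<zeta> p (lie_bracket Y X p)"
    using cotangent_scaleR[OF \<zeta>' lie_bracket_tangent[OF Y X], of "-1"] by simp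
  have 2: "W p (\<lambda>q. \<xi> q (Y q) - \<eta> q (X q)) = - W p (\<lambda>q. \<eta> q (X q) - \<xi> q (Y q))"
    using tangent_diff[OF W'] one_form_smooth[OF \<xi> Y] one_form_smooth[OF \<eta> X] by simp
  show ?thesis
    using 1 2 W'
    by (simp add: g_can_def courant_bracket_def Let_def case_prod_unfold defs[symmetric]
        differential_def scaleR_fun_apply)
      (simp add: field_simps)
qed

text \<open>The bump serves twice: as the function, and as the cutoff of a coordinate vector field.\<close>

lemma exists_nonvanishing_derivative:
  obtains X f p where "X \<in> vector_fields A" "f \<in> smooth_functions A" "X p f \<noteq> 0"
proof -
  obtain U \<phi> p\<^sub>0 where chart: "(U, \<phi>) \<in> A" and "p\<^sub>0 \<in> U"
    using atlas unfolding smooth_atlas_def by blast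
  then obtain r where r: "r > 0" "cball (\<phi> p\<^sub>0) r \<subseteq> \<phi> ` U"
    using open_image[OF chart] open_contains_cball by blast
  let ?K = "cball (\<phi> p\<^sub>0) r" and ?i = "inv_into U \<phi>"
  obtain \<beta> :: "real ^ 'n \<Rightarrow> real" and x e where \<beta>: "smooth_on UNIV \<beta>" "\<forall>y. y \<notin> ?K \<longrightarrow> \<beta> y = 0"
    and x: "x \<in> ?K" "\<beta> x \<noteq> 0" "frechet_derivative \<beta> (at x) e \<noteq> 0"
    by (rule smooth_bump[OF r(1), of "\<phi> p\<^sub>0"])
  have smooth_\<beta>: "smooth_on (\<phi> ` U) \<beta>"
    using \<beta>(1) Ck_on_subset unfolding smooth_on_def by blast
  have inv: "?i (\<phi> q) = q" if "q \<in> U" for q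
    using inj_chart[OF chart] that by simp
  define D where "D g q = frechet_derivative (\<lambda>x. g (?i x)) (at (\<phi> q)) e" for g :: "'m \<Rightarrow> real" and q
  \<comment> \<open>The factor \<open>\<beta>\<close> permits extension by zero outside
    \<open>U\<close>; the value 0 on nonsmooth \<open>g\<close> is the convention for tangent
    vectors.\<close>
  define X where "X q g = (if g \<in> smooth_functions A \<and> q \<in> U then \<beta> (\<phi> q) * D g q else 0)" for q g
  define f where "f q = (if q \<in> U then \<beta> (\<phi> q) else 0)" for q
  have f: "f \<in> smooth_functions A"
    unfolding f_def[abs_def]
    by (rule smooth_functions_extend[OF chart compact_cball r(2) smooth_\<beta>]) (simp add: \<beta>(2))
  have chart_smooth: "smooth_on (\<phi> ` U) (\<lambda>x. g (?i x))" if "g \<in> smooth_functions A" for g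
    using that chart unfolding smooth_functions_iff by blast
  have deriv: "((\<lambda>x. g (?i x)) has_derivative
      frechet_derivative (\<lambda>x. g (?i x)) (at (\<phi> q))) (at (\<phi> q))"
    if "g \<in> smooth_functions A" "q \<in> U" for g q
    using smooth_on_differentiable[OF chart_smooth[OF that(1)], of "\<phi> q"] that(2)
    by (simp add: frechet_derivative_works)
  have D_eqI: "D g q = D' e" if "((\<lambda>x. g (?i x)) has_derivative D') (at (\<phi> q))" for g q D'
    using frechet_derivative_at[OF that] by (simp add: D_def)
  have D_add: "D (\<lambda>q. g q + h q) q = D g q + D h q"
    and D_mult: "D (\<lambda>q. g q * h q) q = g q * D h q + h q * D g q"
    if "g \<in> smooth_functions A" "h \<in> smooth_functions A" "q \<in> U" for g h q
    using D_eqI[OF has_derivative_add[OF deriv[OF that(1,3)] deriv[OF that(2,3)]]]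
      D_eqI[OF has_derivative_mult[OF deriv[OF that(1,3)] deriv[OF that(2,3)]]]
    by (simp_all add: inv[OF that(3)] D_def mult.commute)
  have D_const: "D (\<lambda>q. c) q = 0" for c q
    using D_eqI[of "\<lambda>q. c" "\<lambda>v. 0"] by simp
  have "X q \<in> tangent_space A q" for q
  proof (rule tangent_spaceI)
    fix c g
    assume g: "g \<in> smooth_functions A"
    \<comment> \<open>Homogeneity is the Leibniz rule with a constant factor, whose derivative is
      0.\<close>
    show "X q (\<lambda>q. c * g q) = c * X q g"
      using D_mult[OF smooth_functions_const g, of q c] g
      by (simp add: X_def smooth_functions_cmult D_const)
  qed (simp_all add: X_def smooth_functions_add smooth_functions_mult D_add D_mult algebra_simps)
  moreover have "(\<lambda>q. X q g) \<in> smooth_functions A" if g: "g \<in> smooth_functions A" for g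
  proof -
    let ?h = "\<lambda>x. \<beta> x * frechet_derivative (\<lambda>x. g (?i x)) (at x) e"
    have "smooth_on (\<phi> ` U) ?h"
      using open_image[OF chart] smooth_\<beta> smooth_on_derivative[OF chart_smooth[OF g]]
      by (rule smooth_on_mult)
    then have "(\<lambda>q. if q \<in> U then ?h (\<phi> q) else 0) \<in> smooth_functions A"
      by (rule smooth_functions_extend[OF chart compact_cball r(2)]) (simp add: \<beta>(2))
    then show ?thesis
      using g by (simp add: X_def D_def cong: if_cong)
  qed
  ultimately have "X \<in> vector_fields A"
    by (simp add: vector_fields_def)
  moreover obtain p where p: "p \<in> U" "x = \<phi> p"
    using x(1) r(2) by blast
  \<comment> \<open>In the chart \<open>f\<close> is \<open>\<beta>\<close>, so \<open>X p f\<close>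
    is \<open>\<beta> x\<close> times the derivative of \<open>\<beta>\<close> at \<open>x\<close>
    along \<open>e\<close>, both nonzero.\<close>
  moreover have "D f p = frechet_derivative \<beta> (at x) e"
    unfolding D_def p(2)
    by (rule fun_cong[OF frechet_derivative_cong_open[OF open_image[OF chart]]])
      (use p(1) inv in \<open>auto simp: f_def\<close>)
  ultimately show ?thesis
    using that[of X f p] f x by (simp add: X_def)
qed

end

section \<open>Symmetry and linearity of the canonical pairing\<close>

lemma g_can_commute: "g_can u v = g_can v u"
  by (simp add: g_can_def case_prod_unfold)

text \<open>Covector components add pointwise as functions, so tangency of the vector components
  suffices. This is what is known about values of Courant brackets.\<close>

lemma (in smooth_manifold) g_can_linear:
  assumes "w \<in> gen_space A p" "fst u \<in> tangent_space A p" "fst v \<in> tangent_space A p"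
  shows g_can_plus: "g_can (u + v) w = g_can u w + g_can v w"
    and g_can_minus: "g_can (u - v) w = g_can u w - g_can v w"
proof -
  have w: "snd w \<in> cotangent_space A p"
    using assms by (auto simp: gen_space_def)
  show "g_can (u + v) w = g_can u w + g_can v w" "g_can (u - v) w = g_can u w - g_can v w"
    using cotangent_plus[OF w assms(2,3)] cotangent_minus[OF w assms(2,3)]
    by (simp_all add: g_can_def case_prod_unfold add_divide_distrib diff_divide_distrib)
qed

lemma (in smooth_manifold) g_can_uminus:
  assumes "w \<in> gen_space A p" "v \<in> gen_space A p"
  shows "g_can (- v) w = - g_can v w"
proof -
  have w: "snd w \<in> cotangent_space A p" and v: "fst v \<in> tangent_space A p"
    using assms by (auto simp: gen_space_def)
  show ?thesis
    using cotangent_scaleR[OF w v, of "-1"]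
    by (simp add: g_can_def case_prod_unfold field_simps)
qed

theorem lemma13:
  fixes A :: "('m::{t2_space, second_countable_topology}, 'n::finite) chart set"
    and J :: "'m \<Rightarrow> 'm gvec \<Rightarrow> 'm gvec"
  assumes "smooth_atlas A"
    and "symmetric_gen_complex A J"
  shows "\<not> courant_integrable A J"
proof
  assume integrable: "courant_integrable A J"
  interpret smooth_manifold A
    by standard (rule assms(1))
  have J_mem: "J q x \<in> gen_space A q" if "x \<in> gen_space A q" for q x
    using assms(2) that unfolding symmetric_gen_complex_def by blast
  have J_scaleR: "J q (c *\<^sub>R x) = c *\<^sub>R J q x" if "x \<in> gen_space A q" for q c x
    using assms(2) that unfolding symmetric_gen_complex_def linear_map_on_def by blast
  have J_section: "(\<lambda>q. J q (a q)) \<in> gen_sections A" if "a \<in> gen_sections A" for a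
    using assms(2) that unfolding symmetric_gen_complex_def by blast
  have J_sym: "g_can (J q x) y = g_can x (J q y)"
    if "x \<in> gen_space A q" "y \<in> gen_space A q" for q x y
    using assms(2) that unfolding symmetric_gen_complex_def by blast
  have J_square: "J q (J q x) = - x" if "x \<in> gen_space A q" for q x
    using assms(2) that unfolding symmetric_gen_complex_def by blast
  obtain X f p where X: "X \<in> vector_fields A" and f: "f \<in> smooth_functions A"
    and nonzero: "X p f \<noteq> 0"
    using exists_nonvanishing_derivative .
  define u where "u q = (X q, differential A f q)" for q
  define Ju where "Ju q = J q (u q)" for q
  have u: "u \<in> gen_sections A"
    using X differential_one_form[OF f] by (simp add: u_def gen_sections_def)
  have Ju: "Ju \<in> gen_sections A"
    unfolding Ju_def[abs_def] using u by (rule J_section)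
  note u_mem = gen_section_mem[OF u] and Ju_mem = gen_section_mem[OF Ju]
  have JJu: "J q (Ju q) = - u q" for q
    using J_square[OF u_mem] by (simp add: Ju_def)
  define s where "s q = (Ju q, u q)" for q
  define t where "t q = (f q *\<^sub>R Ju q, f q *\<^sub>R u q)" for q
  note fu = gen_section_scale[OF f u] and fJu = gen_section_scale[OF f Ju]
  \<comment> \<open>\<open>J\<close> sends Ju + i u to -u + i Ju = i (Ju + i u), and a real factor
    \<open>f\<close> preserves this relation.\<close>
  have "s \<in> holomorphic_sections A J"
    using u Ju u_mem Ju_mem JJu
    by (simp add: holomorphic_sections_def complex_sections_def holomorphic_bundle_def s_def
        complex_ext_def times_i_def Ju_def[symmetric])
  moreover have "t \<in> holomorphic_sections A J"
    using fu fJu gen_section_mem[OF fu] gen_section_mem[OF fJu] J_scaleR[OF u_mem]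
      J_scaleR[OF Ju_mem] JJu
    by (simp add: holomorphic_sections_def complex_sections_def holomorphic_bundle_def t_def
        complex_ext_def times_i_def Ju_def[symmetric])
  ultimately have st: "complex_courant_bracket A s t \<in> holomorphic_sections A J"
    using integrable by (simp add: courant_integrable_def)
  \<comment> \<open>Real and imaginary part of the bracket of \<open>s\<close> and
    \<open>f s\<close> at \<open>p\<close>.\<close>
  define R where "R = courant_bracket A Ju (\<lambda>q. f q *\<^sub>R Ju q) p -
    courant_bracket A u (\<lambda>q. f q *\<^sub>R u q) p"
  define I where "I = courant_bracket A Ju (\<lambda>q. f q *\<^sub>R u q) p +
    courant_bracket A u (\<lambda>q. f q *\<^sub>R Ju q) p"
  have "complex_courant_bracket A s t p \<in> holomorphic_bundle A J p"
    using st by (simp add: holomorphic_sections_def)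
  moreover have "complex_courant_bracket A s t p = (R, I)"
    by (simp add: complex_courant_bracket_def s_def t_def R_def I_def Let_def)
  ultimately have "(R, I) \<in> holomorphic_bundle A J p"
    by simp
  then have R: "R \<in> gen_space A p" and I: "I \<in> gen_space A p" and JR: "J p R = - I"
    by (auto simp: holomorphic_bundle_def complex_ext_def times_i_def)
  \<comment> \<open>Symmetry of \<open>J\<close> turns membership of R + i I in L into a relation
    between pairings, the only form in which the brackets have been computed.\<close>
  have key: "g_can R (J p x) = - g_can I x" if "x \<in> gen_space A p" for x
    using J_sym[OF R that] g_can_uminus[OF that I] by (simp add: JR)
  let ?k = "g_can (u p) (u p)" and ?l = "g_can (u p) (Ju p)"
    and ?Xf = "fst (u p) f" and ?Yf = "fst (Ju p) f"
  have JuJu: "g_can (Ju p) (Ju p) = - ?k"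
    using J_sym[OF u_mem Ju_mem, of p] g_can_uminus[OF u_mem u_mem, of p]
      g_can_commute[of "u p" "- u p"]
    by (simp add: JJu Ju_def[symmetric])
  have bracket_tangent: "fst (courant_bracket A a b p) \<in> tangent_space A p"
    if "a \<in> gen_sections A" "b \<in> gen_sections A" for a b
    using that lie_bracket_tangent by (simp add: courant_bracket_def Let_def gen_sections_def)
  \<comment> \<open>The brackets of \<open>u\<close> and of \<open>Ju\<close> with themselves pair
    to 0 by antisymmetry. Since \<open>Ju\<close> has square \<open>- ?k\<close>, the two halves of
    the \<open>df\<close> term add instead of cancelling.\<close>
  have pair_R: "g_can R (v p) = ?Yf * g_can (Ju p) (v p) - ?Xf * g_can (u p) (v p) +
      ?k * fst (v p) f"
    if v: "v \<in> gen_sections A" for v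
    using courant_bracket_antisym[OF u u v, of p] courant_bracket_antisym[OF Ju Ju v, of p]
    by (simp add: R_def g_can_minus[OF gen_section_mem[OF v] bracket_tangent[OF Ju fJu]
          bracket_tangent[OF u fu]] courant_bracket_scale[OF u u v f]
        courant_bracket_scale[OF Ju Ju v f] JuJu)
  \<comment> \<open>Here the bracket of \<open>Ju\<close> with \<open>u\<close> cancels against that
    of \<open>u\<close> with \<open>Ju\<close>, and the two halves of the \<open>df\<close> term are
    equal.\<close>
  have pair_I: "g_can I (v p) = ?Xf * g_can (Ju p) (v p) + ?Yf * g_can (u p) (v p) -
      ?l * fst (v p) f"
    if v: "v \<in> gen_sections A" for v
    using courant_bracket_antisym[OF u Ju v, of p]
    by (simp add: I_def g_can_plus[OF gen_section_mem[OF v] bracket_tangent[OF Ju fu]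
          bracket_tangent[OF u fJu]] courant_bracket_scale[OF u Ju v f]
        courant_bracket_scale[OF Ju u v f] g_can_commute[of "Ju p" "u p"])
  \<comment> \<open>Facts \<open>1\<close> and \<open>2\<close> are the real and imaginary part of
    \<langle>s, s\<rangle> (\<open>?Yf\<close> - i \<open>?Xf\<close>) = 0, with \<langle>s,
    s\<rangle> = -2 \<open>?k\<close> + 2 i \<open>?l\<close>. They express that \<langle>s,
    s\<rangle> df is orthogonal to the conjugate of s, as L is to its conjugate for symmetric
    \<open>J\<close>.\<close>
  have 1: "?l * ?Xf = ?k * ?Yf"
    using key[OF u_mem] pair_R[OF Ju] pair_I[OF u] JuJu
    by (simp add: Ju_def[symmetric] g_can_commute[of "Ju p" "u p"] mult.commute)
  have "g_can R (- u p) = - g_can R (u p)"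
    using g_can_uminus[OF R u_mem] g_can_commute by metis
  then have 2: "?k * ?Xf = - (?l * ?Yf)"
    using key[OF Ju_mem] pair_R[OF u] pair_I[OF Ju] JuJu
    by (simp add: JJu g_can_commute[of "Ju p" "u p"] mult.commute)
  have "?k = X p f" "?Xf = X p f"
    using vector_field_tangent[OF X, of p] by (simp_all add: u_def g_can_def differential_def)
  \<comment> \<open>Fact \<open>1\<close> times \<open>?l\<close> plus fact \<open>2\<close> times
    \<open>?k\<close> eliminates \<open>?Yf\<close>. Both \<open>?k\<close> and \<open>?Xf\<close>
    equal the nonzero number \<open>X p f\<close>, so the product cannot vanish.\<close>
  moreover have "(?k\<^sup>2 + ?l\<^sup>2) * ?Xf = 0"
    using 1 2 by algebra
  ultimately show False
    using nonzero by (simp add: sum_power2_eq_zero_iff)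
qed

end
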